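(* A family of $N$-partite joint measurements satisfying the nonsignaling condition need not consist of EPR local joint measurements. That is, there exist an integer $N$, an assignment $(\mathcal{E},s)\mapsto P^{(\mathcal{E})}_s$ of joint probability distributions to the joint measurements $s=(s_1,\dots,s_N)$ of $N$-partite experiments $\mathcal{E}$, and an experiment $\mathcal{E}$ whose family $\{P^{(\mathcal{E})}_s : s\in\mathcal{E}\}$ satisfies the nonsignaling condition, while some joint measurement $s\in\mathcal{E}$ is not EPR local.
   Context: Fix $N$ and for each site $n=1,\dots,N$ a set $A_n$ of possible measurement settings, each setting $a\in A_n$ having a measurable outcome space $\Lambda_n^{(a)}$. An $N$-partite experiment is a family $\mathcal{E}=E_1\times\dots\times E_N$ with finite nonempty $E_n\subseteq A_n$; its elements $s=(s_1,\dots,s_N)$ are its joint measurements. To each experiment $\mathcal{E}$ and each $s\in\mathcal{E}$ there is assigned a probability distribution $P^{(\mathcal{E})}_s$ on $\Lambda_1^{(s_1)}\times\dots\times\Lambda_N^{(s_N)}$, which may depend not only on $s$ but also on the whole experiment $\mathcal{E}$ (in particular on the other settings in $\mathcal{E}$). Nonsignaling condition for $\mathcal{E}$: for any $s,s'\in\mathcal{E}$ and any sites $1\le n_1<\dots<n_M\le N$, $1\le M<N$, with $s_{n_j}=s'_{n_j}$ for $j=1,\dots,M$, the marginals of $P^{(\mathcal{E})}_s$ and $P^{(\mathcal{E})}_{s'}$ on $\Lambda_{n_1}^{(s_{n_1})}\times\dots\times\Lambda_{n_M}^{(s_{n_M})}$ coincide. EPR locality: a joint measurement $s\in\mathcal{E}$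 is EPR local if $P^{(\mathcal{E})}_s$ and all its marginals depend only on the settings of the corresponding measurements at the corresponding sites; that is, for every $1\le M\le N$ and all $1\le n_1<\dots<n_M\le N$, the marginal of $P^{(\mathcal{E})}_s$ on $\Lambda_{n_1}^{(s_{n_1})}\times\dots\times\Lambda_{n_M}^{(s_{n_M})}$ equals the corresponding marginal of $P^{(\mathcal{E}')}_{s'}$ for every experiment $\mathcal{E}'$ and every $s'\in\mathcal{E}'$ with $s'_{n_j}=s_{n_j}$, $j=1,\dots,M$. *)

theory Defs
  imports "HOL-Probability.Probability"
begin

text \<open>
  Sites are the numbers \<open>1, \<dots>, N\<close>, and \<open>A n\<close> is the set of settings at site \<open>n\<close>. The measure
  \<open>\<Lambda> n a\<close> is used only as a measurable space, through its carrier and its sigma-algebra.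
\<close>

definition experiments :: "nat \<Rightarrow> (nat \<Rightarrow> 'a set) \<Rightarrow> (nat \<Rightarrow> 'a) set set" where
  "experiments N A =
     {PiE {1..N} E | E. \<forall>n\<in>{1..N}. E n \<subseteq> A n \<and> finite (E n) \<and> E n \<noteq> {}}"

definition outcome_space ::
  "(nat \<Rightarrow> 'a \<Rightarrow> 'b measure) \<Rightarrow> nat set \<Rightarrow> (nat \<Rightarrow> 'a) \<Rightarrow> (nat \<Rightarrow> 'b) measure" where
  "outcome_space \<Lambda> J s = PiM J (\<lambda>n. \<Lambda> n (s n))"

text \<open>
  The distribution \<open>P \<E> s\<close> may depend on the whole experiment \<open>\<E>\<close>. An experiment is the product
  set itself, not the family of its factors, so that \<open>P\<close> cannot depend on values of the family
  outside \<open>{1..N}\<close>. Nothing is required of \<open>P\<close> outside the experiments.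
\<close>

definition distribution_assignment ::
  "nat \<Rightarrow> (nat \<Rightarrow> 'a set) \<Rightarrow> (nat \<Rightarrow> 'a \<Rightarrow> 'b measure)
    \<Rightarrow> ((nat \<Rightarrow> 'a) set \<Rightarrow> (nat \<Rightarrow> 'a) \<Rightarrow> (nat \<Rightarrow> 'b) measure) \<Rightarrow> bool" where
  "distribution_assignment N A \<Lambda> P \<longleftrightarrow>
     (\<forall>\<E>\<in>experiments N A. \<forall>s\<in>\<E>.
        prob_space (P \<E> s) \<and> sets (P \<E> s) = sets (outcome_space \<Lambda> {1..N} s))"

definition marginal ::
  "(nat \<Rightarrow> 'a \<Rightarrow> 'b measure) \<Rightarrow> ((nat \<Rightarrow> 'a) set \<Rightarrow> (nat \<Rightarrow> 'a) \<Rightarrow> (nat \<Rightarrow> 'b) measure)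
    \<Rightarrow> nat set \<Rightarrow> (nat \<Rightarrow> 'a) set \<Rightarrow> (nat \<Rightarrow> 'a) \<Rightarrow> (nat \<Rightarrow> 'b) measure" where
  "marginal \<Lambda> P J \<E> s = distr (P \<E> s) (outcome_space \<Lambda> J s) (\<lambda>\<omega>. restrict \<omega> J)"

text \<open>
  A choice of sites \<open>n\<^sub>1 < \<dots> < n\<^sub>M\<close> is given by the nonempty set \<open>J\<close> of these sites; it is a
  proper subset of \<open>{1..N}\<close> if and only if \<open>M < N\<close>.
\<close>

definition nonsignaling ::
  "nat \<Rightarrow> (nat \<Rightarrow> 'a \<Rightarrow> 'b measure)
    \<Rightarrow> ((nat \<Rightarrow> 'a) set \<Rightarrow> (nat \<Rightarrow> 'a) \<Rightarrow> (nat \<Rightarrow> 'b) measure)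
    \<Rightarrow> (nat \<Rightarrow> 'a) set \<Rightarrow> bool" where
  "nonsignaling N \<Lambda> P \<E> \<longleftrightarrow>
     (\<forall>s\<in>\<E>. \<forall>s'\<in>\<E>. \<forall>J. J \<noteq> {} \<and> J \<subset> {1..N} \<and> (\<forall>n\<in>J. s n = s' n) \<longrightarrow>
        marginal \<Lambda> P J \<E> s = marginal \<Lambda> P J \<E> s')"

definition EPR_local ::
  "nat \<Rightarrow> (nat \<Rightarrow> 'a set) \<Rightarrow> (nat \<Rightarrow> 'a \<Rightarrow> 'b measure)
    \<Rightarrow> ((nat \<Rightarrow> 'a) set \<Rightarrow> (nat \<Rightarrow> 'a) \<Rightarrow> (nat \<Rightarrow> 'b) measure)
    \<Rightarrow> (nat \<Rightarrow> 'a) set \<Rightarrow> (nat \<Rightarrow> 'a) \<Rightarrow> bool" where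
  "EPR_local N A \<Lambda> P \<E> s \<longleftrightarrow>
     (\<forall>\<E>'\<in>experiments N A. \<forall>s'\<in>\<E>'.
        \<forall>J. J \<noteq> {} \<and> J \<subseteq> {1..N} \<and> (\<forall>n\<in>J. s' n = s n) \<longrightarrow>
          marginal \<Lambda> P J \<E> s = marginal \<Lambda> P J \<E>' s')"

end

theory Submission
  imports Defs
begin

text \<open>
  Let every site deterministically output a value \<open>c \<E>\<close> that depends on the experiment as a whole
  but not on the chosen settings. Within one experiment nothing depends on the settings, so there
  is no signaling; the joint measurement \<open>(0, 0)\<close> nevertheless yields different outcomes in two
  experiments that both contain it, so it is not EPR local.
\<close>

text \<open>The point mass sits at a restricted function because points of a \<open>PiM\<close>
  space must be extensional.\<close>

definition constant_outcomes ::
  "nat \<Rightarrow> ((nat \<Rightarrow> 'a) set \<Rightarrow> real) \<Rightarrow> (nat \<Rightarrow> 'a) set \<Rightarrow> (nat \<Rightarrow> 'a) \<Rightarrow> (nat \<Rightarrow> real) measure" where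
  "constant_outcomes N c \<E> s = return (PiM {1..N} (\<lambda>_. borel)) (\<lambda>n\<in>{1..N}. c \<E>)"

lemma distribution_assignment_constant_outcomes:
  "distribution_assignment N A (\<lambda>_ _. borel) (constant_outcomes N c)"
  by (auto simp: distribution_assignment_def constant_outcomes_def outcome_space_def space_PiM
      intro!: prob_space_return)

text \<open>A point mass pushed forward along a measurable map is the point mass at the image point.
  The right-hand side no longer mentions \<open>s\<close>, which is what rules out
  signaling.\<close>

lemma marginal_constant_outcomes:
  assumes "J \<subseteq> {1..N}"
  shows "marginal (\<lambda>_ _. borel) (constant_outcomes N c) J \<E> s =
    return (PiM J (\<lambda>_. borel)) (\<lambda>n\<in>J. c \<E>)"
proof -
  have "(\<lambda>n\<in>{1..N}. c \<E>) \<in> space (PiM {1..N} (\<lambda>_. borel))"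
    by (simp add: space_PiM)
  moreover have "(\<lambda>\<omega>. restrict \<omega> J) \<in> measurable (PiM {1..N} (\<lambda>_. borel)) (PiM J (\<lambda>_. borel :: real measure))"
    using assms by (rule measurable_restrict_subset)
  moreover have "restrict (\<lambda>n\<in>{1..N}. c \<E>) J = (\<lambda>n\<in>J. c \<E>)"
    using assms by (auto simp: fun_eq_iff restrict_def)
  ultimately show ?thesis
    by (simp add: marginal_def constant_outcomes_def outcome_space_def distr_return)
qed

lemma nonsignaling_constant_outcomes:
  "nonsignaling N (\<lambda>_ _. borel) (constant_outcomes N c) \<E>"
  by (auto simp: nonsignaling_def marginal_constant_outcomes psubset_eq)

text \<open>Distinct points are told apart by a measurable singleton: finiteness of \<open>J\<close>
  makes it measurable, and nonemptiness supplies a coordinate at which to compare \<open>x\<close>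
  with \<open>y\<close>.\<close>

lemma return_PiM_borel_const_eq_iff:
  fixes x y :: real
  assumes "finite J" "J \<noteq> {}"
  shows "return (PiM J (\<lambda>_. borel)) (\<lambda>n\<in>J. x) = return (PiM J (\<lambda>_. borel)) (\<lambda>n\<in>J. y) \<longleftrightarrow> x = y"
proof
  \<comment> \<open>This box contains only the first point, so the first measure gives it mass 1;
    the second must then charge it too.\<close>
  let ?B = "PiE J (\<lambda>_. {x})"
  assume "return (PiM J (\<lambda>_. borel)) (\<lambda>n\<in>J. x) = return (PiM J (\<lambda>_. borel)) (\<lambda>n\<in>J. y)"
  then have "emeasure (return (PiM J (\<lambda>_. borel)) (\<lambda>n\<in>J. x)) ?B =
      emeasure (return (PiM J (\<lambda>_. borel)) (\<lambda>n\<in>J. y)) ?B"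
    by simp
  moreover have "?B \<in> sets (PiM J (\<lambda>_. borel))"
    using assms by (intro sets_PiM_I_finite) auto
  ultimately have "(\<lambda>n\<in>J. y) \<in> ?B"
    by (auto simp: indicator_def split: if_splits)
  with assms show "x = y"
    by (metis PiE_mem equals0I restrict_apply' singletonD)
qed simp

text \<open>EPR locality is tested on the full set of sites, nonempty by \<open>1 \<le> N\<close>,
  comparing \<open>s\<close> with itself in the two experiments.\<close>

lemma not_EPR_local_constant_outcomes:
  assumes "1 \<le> N" "\<E>' \<in> experiments N A" "s \<in> \<E>'" "c \<E> \<noteq> c \<E>'"
  shows "\<not> EPR_local N A (\<lambda>_ _. borel) (constant_outcomes N c) \<E> s"
proof
  assume "EPR_local N A (\<lambda>_ _. borel) (constant_outcomes N c) \<E> s"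
  then have "marginal (\<lambda>_ _. borel) (constant_outcomes N c) {1..N} \<E> s =
      marginal (\<lambda>_ _. borel) (constant_outcomes N c) {1..N} \<E>' s"
    using assms unfolding EPR_local_def by simp
  with assms show False
    by (simp add: marginal_constant_outcomes return_PiM_borel_const_eq_iff)
qed

theorem proposition1:
  "\<exists>(N::nat) (A :: nat \<Rightarrow> nat set) (\<Lambda> :: nat \<Rightarrow> nat \<Rightarrow> real measure)
      (P :: (nat \<Rightarrow> nat) set \<Rightarrow> (nat \<Rightarrow> nat) \<Rightarrow> (nat \<Rightarrow> real) measure).
     1 \<le> N \<and> distribution_assignment N A \<Lambda> P \<and>
     (\<exists>\<E>\<in>experiments N A. nonsignaling N \<Lambda> P \<E> \<and> (\<exists>s\<in>\<E>. \<not> EPR_local N A \<Lambda> P \<E> s))"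
proof -
  define A :: "nat \<Rightarrow> nat set" where "A = (\<lambda>_. {0, 1})"
  \<comment> \<open>With two sites and two settings at each, distinct joint measurements in
    \<open>\<E>\<close> can agree at one site, so nonsignaling is not vacuous. The smaller
    experiment \<open>\<E>'\<close> still contains \<open>s\<close>.\<close>
  define \<E> \<E>' :: "(nat \<Rightarrow> nat) set"
    where "\<E> = PiE {1..2} (\<lambda>_. {0, 1})" and "\<E>' = PiE {1..2} (\<lambda>_. {0})"
  define s :: "nat \<Rightarrow> nat" where "s = (\<lambda>n\<in>{1..2}. 0)"
  define c :: "(nat \<Rightarrow> nat) set \<Rightarrow> real" where "c = (\<lambda>\<F>. if \<F> = \<E> then 0 else 1)"
  have exps: "\<E> \<in> experiments 2 A" "\<E>' \<in> experiments 2 A"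
    unfolding experiments_def \<E>_def \<E>'_def A_def by blast+
  have s: "s \<in> \<E>" "s \<in> \<E>'"
    by (auto simp: s_def \<E>_def \<E>'_def)
  \<comment> \<open>The all-ones measurement witnesses \<open>\<E> \<noteq> \<E>'\<close>, so
    \<open>c\<close> takes the values 0 and 1 on them.\<close>
  have "(\<lambda>n\<in>{1..2}. 1) \<in> \<E>"
    by (simp add: \<E>_def)
  moreover have "f 1 = 0" if "f \<in> \<E>'" for f
    using PiE_mem[of f "{1..2}" "\<lambda>_. {0}" 1] that by (simp add: \<E>'_def)
  then have "(\<lambda>n\<in>{1..2}. 1) \<notin> \<E>'"
    by fastforce
  ultimately have "c \<E> \<noteq> c \<E>'"
    by (auto simp: c_def)
  then have "\<not> EPR_local 2 A (\<lambda>_ _. borel) (constant_outcomes 2 c) \<E> s"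
    using exps s by (intro not_EPR_local_constant_outcomes) auto
  then have "1 \<le> (2::nat) \<and> distribution_assignment 2 A (\<lambda>_ _. borel) (constant_outcomes 2 c) \<and>
      (\<exists>\<E>\<in>experiments 2 A. nonsignaling 2 (\<lambda>_ _. borel) (constant_outcomes 2 c) \<E> \<and>
        (\<exists>s\<in>\<E>. \<not> EPR_local 2 A (\<lambda>_ _. borel) (constant_outcomes 2 c) \<E> s))"
    using distribution_assignment_constant_outcomes nonsignaling_constant_outcomes exps(1) s(1)
    by (intro conjI bexI[of _ \<E>] bexI[of _ s]) simp_all
  then show ?thesis
    by (intro exI)
qed

end
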